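(* Let $d\ge3$ and let $X\subset S^{d-1}$ be a tight spherical $4$-design. Let $\{\langle x,y\rangle\mid x,y\in X,\ x\neq y\}=\{\alpha_1,\dots,\alpha_s\}$ (distinct values), $\alpha_0=1$, and $R_k=\{(x,y)\in X\times X\mid\langle x,y\rangle=\alpha_k\}$ for $0\le k\le s$. Then $(X,\{R_k\}_{k=0}^s)$ is a triply regular association scheme.
   Context: $S^{d-1}$ is the unit sphere in $\mathbb{R}^d$. A finite non-empty $X\subset S^{d-1}$ is a spherical $t$-design if the average over $X$ of every real polynomial of degree at most $t$ equals its average over $S^{d-1}$ (uniform measure). A spherical $t$-design with $t$ even satisfies $|X|\ge\binom{d+t/2-1}{t/2}+\binom{d+t/2-2}{t/2-1}$; it is called tight if equality holds. Symmetric association scheme: a finite set $X$ with a partition $\{R_k\}_{k=0}^s$ of $X\times X$ into symmetric relations, $R_0$ being the diagonal, such that for all $i,j,k$ the number $|\{w\in X\mid(x,w)\in R_i,(w,y)\in R_j\}|$ is independent of the choice of $(x,y)\in R_k$. A symmetric association scheme is triply regular if for all $i,j,k,l,m,n\in\{0,\dots,s\}$ and all $x,y,z\in X$ with $(x,y)\in R_i$, $(y,z)\in R_j$, $(z,x)\in R_k$, the number $|\{w\in X\mid(w,x)\in R_m,(w,y)\in R_n,(w,z)\in R_l\}|$ depends only on $i,j,k,l,m,n$ and not on $x,y,z$. *)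

theory Defs
  imports "HOL-Analysis.Analysis" "HOL-Probability.Probability_Measure"
begin

text \<open>Distributing the uniform probability measure of the unit ball along radial projection
  gives the rotation-invariant probability measure on the unit sphere (the origin, which
  \<^const>\<open>sgn\<close> fixes, is a null set). The measure lives on the whole space and is
  concentrated on the sphere.\<close>

definition uniform_sphere :: "(real ^ 'n) measure" where
  "uniform_sphere = distr (uniform_measure lborel (ball 0 1)) borel sgn"

lemma prob_space_uniform_sphere: "prob_space uniform_sphere"
proof -
  have "prob_space (uniform_measure lborel (ball (0 :: real ^ 'n) 1))"
  proof (rule prob_space_uniform_measure)
    have "emeasure lborel (ball (0 :: real ^ 'n) 1) = ennreal (measure lborel (ball (0 :: real ^ 'n) 1))"
      by (rule emeasure_eq_ennreal_measure) (use emeasure_lborel_ball_finite in \<open>simp add: less_top\<close>)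
    then show "emeasure lborel (ball (0 :: real ^ 'n) 1) \<noteq> 0"
      using content_ball_pos[of 1 "0 :: real ^ 'n"] by simp
    show "emeasure lborel (ball (0 :: real ^ 'n) 1) \<noteq> \<infinity>"
      using emeasure_lborel_ball_finite[of "0 :: real ^ 'n" 1] by simp
  qed
  moreover have "sgn \<in> borel_measurable (uniform_measure lborel (ball (0 :: real ^ 'n) 1))"
    by (simp add: sgn_div_norm[abs_def])
  ultimately show ?thesis
    unfolding uniform_sphere_def by (rule prob_space.prob_space_distr)
qed

definition monomial_fun :: "('n::finite \<Rightarrow> nat) \<Rightarrow> real ^ 'n \<Rightarrow> real" where
  "monomial_fun a x = (\<Prod>i\<in>UNIV. (x $ i) ^ a i)"

definition polynomial_fun_le :: "nat \<Rightarrow> (real ^ 'n \<Rightarrow> real) \<Rightarrow> bool" where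
  "polynomial_fun_le t f \<longleftrightarrow>
     (\<exists>c. f = (\<lambda>x. \<Sum>a | sum a UNIV \<le> t. c a * monomial_fun a x))"

lemma finite_exponents: "finite {a :: 'n::finite \<Rightarrow> nat. sum a UNIV \<le> t}"
proof (rule finite_subset)
  show "{a :: 'n \<Rightarrow> nat. sum a UNIV \<le> t} \<subseteq> (UNIV :: 'n set) \<rightarrow>\<^sub>E {..t}"
  proof
    fix a :: "'n \<Rightarrow> nat" assume a: "a \<in> {a. sum a UNIV \<le> t}"
    have "a i \<le> t" for i
      using member_le_sum[of i UNIV a] a by simp
    then show "a \<in> UNIV \<rightarrow>\<^sub>E {..t}"
      by (simp add: PiE_def Pi_def)
  qed
qed (simp add: finite_PiE)

definition spherical_design :: "nat \<Rightarrow> (real ^ 'n) set \<Rightarrow> bool" where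
  "spherical_design t X \<longleftrightarrow>
     finite X \<and> X \<noteq> {} \<and> X \<subseteq> sphere 0 1 \<and>
     (\<forall>f. polynomial_fun_le t f \<longrightarrow>
        (\<Sum>x\<in>X. f x) / real (card X) = (\<integral>x. f x \<partial>uniform_sphere))"

text \<open>For \<open>t = 0\<close> the second binomial coefficient has lower index \<open>- 1\<close> and
  is read as \<open>0\<close>; truncated subtraction would give a different value.\<close>

definition tight_spherical_design :: "nat \<Rightarrow> (real ^ 'n) set \<Rightarrow> bool" where
  "tight_spherical_design t X \<longleftrightarrow>
     even t \<and> spherical_design t X \<and>
     card X = ((CARD('n) + t div 2 - 1) choose (t div 2)) +
       (if t = 0 then 0 else (CARD('n) + t div 2 - 2) choose (t div 2 - 1))"

text \<open>The relations are \<open>R 0, \<dots>, R s\<close>; values of \<open>R\<close> beyond \<open>s\<close> are ignored.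
  As usual for partitions, the classes are required to be non-empty.\<close>

definition symmetric_association_scheme :: "'a set \<Rightarrow> nat \<Rightarrow> (nat \<Rightarrow> ('a \<times> 'a) set) \<Rightarrow> bool" where
  "symmetric_association_scheme X s R \<longleftrightarrow>
     finite X \<and>
     (\<Union>k\<le>s. R k) = X \<times> X \<and> disjoint_family_on R {..s} \<and> (\<forall>k\<le>s. R k \<noteq> {}) \<and>
     (\<forall>k\<le>s. sym (R k)) \<and>
     R 0 = Id_on X \<and>
     (\<forall>i\<le>s. \<forall>j\<le>s. \<forall>k\<le>s. \<exists>p. \<forall>x y. (x, y) \<in> R k \<longrightarrow>
        card {w \<in> X. (x, w) \<in> R i \<and> (w, y) \<in> R j} = p)"

definition triply_regular_scheme :: "'a set \<Rightarrow> nat \<Rightarrow> (nat \<Rightarrow> ('a \<times> 'a) set) \<Rightarrow> bool" where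
  "triply_regular_scheme X s R \<longleftrightarrow>
     symmetric_association_scheme X s R \<and>
     (\<forall>i\<le>s. \<forall>j\<le>s. \<forall>k\<le>s. \<forall>l\<le>s. \<forall>m\<le>s. \<forall>n\<le>s. \<exists>p. \<forall>x\<in>X. \<forall>y\<in>X. \<forall>z\<in>X.
        (x, y) \<in> R i \<longrightarrow> (y, z) \<in> R j \<longrightarrow> (z, x) \<in> R k \<longrightarrow>
        card {w \<in> X. (w, x) \<in> R m \<and> (w, y) \<in> R n \<and> (w, z) \<in> R l} = p)"

end

theory Submission
  imports Defs
begin

text \<open>
  Write \<open>d\<close> for the dimension and \<open>N\<close> for the number of points of \<open>X\<close>. There are two ideas.

  \<^emph>\<open>Two inner products.\<close> Up to a constant factor, \<open>F u = (d + 2) * u\<^sup>2 + 2 * u - 1\<close> is the polynomial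
  for which \<open>F (x \<bullet> w)\<close> is the reproducing kernel of the polynomials of degree at most 2 on the
  sphere. Fix \<open>x\<close> in \<open>X\<close>. The square of \<open>F\<close> has degree 4, so the design determines the sum of
  \<open>(F (x \<bullet> w))\<^sup>2\<close> over all \<open>w\<close> in \<open>X\<close>, and by tightness, \<open>N = d * (d + 3) / 2\<close>, this sum is
  \<open>(d + 3)\<^sup>2\<close>. The term at \<open>w = x\<close> alone is already \<open>(F 1)\<^sup>2 = (d + 3)\<^sup>2\<close>, hence all other terms
  vanish: inner products of distinct points are roots of the quadratic \<open>F\<close>
  (\<open>tight_4_design_inner_root\<close>).

  \<^emph>\<open>Linear indicators.\<close> On a set of two values every function is affine. So for fixed \<open>a\<close> the
  condition \<open>w \<bullet> x = a\<close> has an indicator of the form \<open>p + q * (w \<bullet> x)\<close>, corrected by a constant at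
  \<open>w = x\<close> (\<open>tight_4_design_indicator\<close>). The number of \<open>w\<close> in prescribed relations to \<open>x\<close>, \<open>y\<close> and
  \<open>z\<close> is a sum of products of three such indicators. The product of the affine parts has degree 3
  in \<open>w\<close>, so the design evaluates its sum, and the corrections are supported on \<open>x\<close>, \<open>y\<close>, \<open>z\<close>;
  both contributions involve only \<open>x \<bullet> y\<close>, \<open>y \<bullet> z\<close> and \<open>z \<bullet> x\<close> (\<open>design_triple_sum\<close>). Degenerate
  triples need no separate treatment, and the intersection numbers of the association scheme are
  the triple counts with \<open>z = x\<close>.

  The moments used in both steps come from invariance of the uniform measure under orthogonal
  transformations (\<open>design_power_sum_cong_norm\<close>). It makes the power sum
  \<open>\<Sum>w\<in>X. (x \<bullet> w) ^ k\<close> proportional to \<open>norm x ^ k\<close>, and the constant of proportionality is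
  found by summing over coordinate directions, because the points of \<open>X\<close> are unit vectors.
\<close>

section \<open>Invariance of the uniform measure under orthogonal transformations\<close>

lemma nn_integral_lborel_translate:
  fixes f :: "'a::euclidean_space \<Rightarrow> ennreal"
  assumes [measurable]: "f \<in> borel_measurable borel"
  shows "(\<integral>\<^sup>+x. f (c + x) \<partial>lborel) = (\<integral>\<^sup>+x. f x \<partial>lborel)"
proof -
  have "(\<integral>\<^sup>+x. f x \<partial>lborel) = (\<integral>\<^sup>+x. f x \<partial>distr lborel borel ((+) c))"
    by (simp add: lborel_distr_plus)
  also have "\<dots> = (\<integral>\<^sup>+x. f (c + x) \<partial>lborel)"
    by (subst nn_integral_distr) auto
  finally show ?thesis ..
qed

lemma borel_measurable_orthogonal_transformation:
  fixes T :: "'a::euclidean_space \<Rightarrow> 'a"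
  assumes "orthogonal_transformation T"
  shows "T \<in> borel_measurable borel"
  using assms
  by (intro borel_measurable_continuous_onI linear_continuous_on)
     (simp add: orthogonal_transformation_def linear_conv_bounded_linear)

text \<open>This is the uniqueness argument for Haar measure. Let \<open>g\<close> be the indicator of the unit ball
  and \<open>c\<close> its integral. Three translations and two applications of Fubini's theorem turn
  \<open>(\<integral> f) * c\<close> into \<open>(\<integral> f \<circ> T) * c\<close>; the transformation enters through \<open>g (y - S x) = g (x - T y)\<close>
  for \<open>S\<close> the inverse of \<open>T\<close>.\<close>

lemma nn_integral_lborel_orthogonal:
  fixes f :: "'a::euclidean_space \<Rightarrow> ennreal" and T :: "'a \<Rightarrow> 'a"
  assumes T: "orthogonal_transformation T"
    and f [measurable]: "f \<in> borel_measurable borel"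
  shows "(\<integral>\<^sup>+x. f (T x) \<partial>lborel) = (\<integral>\<^sup>+x. f x \<partial>lborel)"
proof -
  have [measurable]: "T \<in> borel_measurable borel"
    by (rule borel_measurable_orthogonal_transformation [OF T])
  define S where "S = inv T"
  have S: "orthogonal_transformation S"
    unfolding S_def by (rule orthogonal_transformation_inv [OF T])
  have [measurable]: "S \<in> borel_measurable borel"
    by (rule borel_measurable_orthogonal_transformation [OF S])
  have TS: "T (S x) = x" for x
    unfolding S_def by (simp add: orthogonal_transformation_surj [OF T] surj_f_inv_f)
  have lin: "linear T"
    by (rule orthogonal_transformation_linear [OF T])
  define g :: "'a \<Rightarrow> ennreal" where "g = indicator (ball 0 1)"
  have [measurable]: "g \<in> borel_measurable borel"
    unfolding g_def by (rule borel_measurable_indicator) simp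
  define c where "c = (\<integral>\<^sup>+x. g x \<partial>lborel)"
  have c: "c = emeasure lborel (ball (0::'a) 1)"
    by (simp add: c_def g_def)
  have g_shift: "g (y - S x) = g (x - T y)" for x y
  proof -
    have "norm (y - S x) = norm (T (y - S x))"
      by (simp add: orthogonal_transformation_norm [OF T])
    also have "\<dots> = norm (x - T y)"
      by (simp add: linear_diff [OF lin] TS norm_minus_commute)
    finally show ?thesis
      by (simp add: g_def indicator_def)
  qed
  have "(\<integral>\<^sup>+x. f x \<partial>lborel) * c = (\<integral>\<^sup>+y. (\<integral>\<^sup>+x. f x \<partial>lborel) * g y \<partial>lborel)"
    by (simp add: c_def nn_integral_cmult)
  also have "\<dots> = (\<integral>\<^sup>+y. (\<integral>\<^sup>+x. f (T y + x) * g y \<partial>lborel) \<partial>lborel)"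
    by (simp add: nn_integral_multc nn_integral_lborel_translate)
  also have "\<dots> = (\<integral>\<^sup>+x. (\<integral>\<^sup>+y. f (T y + x) * g y \<partial>lborel) \<partial>lborel)"
    by (rule lborel_pair.Fubini') measurable
  also have "\<dots> = (\<integral>\<^sup>+x. (\<integral>\<^sup>+y. f (T y) * g (y - S x) \<partial>lborel) \<partial>lborel)"
  proof (rule nn_integral_cong)
    fix x :: 'a
    have "(\<integral>\<^sup>+y. f (T y + x) * g y \<partial>lborel)
        = (\<integral>\<^sup>+y. f (T (S x + y)) * g ((S x + y) - S x) \<partial>lborel)"
      by (simp add: linear_add [OF lin] TS add.commute)
    also have "\<dots> = (\<integral>\<^sup>+y. f (T y) * g (y - S x) \<partial>lborel)"
      by (rule nn_integral_lborel_translate) measurable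
    finally show "(\<integral>\<^sup>+y. f (T y + x) * g y \<partial>lborel) = (\<integral>\<^sup>+y. f (T y) * g (y - S x) \<partial>lborel)" .
  qed
  also have "\<dots> = (\<integral>\<^sup>+x. (\<integral>\<^sup>+y. f (T y) * g (- T y + x) \<partial>lborel) \<partial>lborel)"
    by (simp add: g_shift)
  also have "\<dots> = (\<integral>\<^sup>+y. (\<integral>\<^sup>+x. f (T y) * g (- T y + x) \<partial>lborel) \<partial>lborel)"
    by (rule lborel_pair.Fubini') measurable
  also have "\<dots> = (\<integral>\<^sup>+y. f (T y) * c \<partial>lborel)"
  proof (rule nn_integral_cong)
    fix y :: 'a
    have "(\<integral>\<^sup>+x. g (- T y + x) \<partial>lborel) = c"
      unfolding c_def by (rule nn_integral_lborel_translate) measurable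
    then show "(\<integral>\<^sup>+x. f (T y) * g (- T y + x) \<partial>lborel) = f (T y) * c"
      by (subst nn_integral_cmult) auto
  qed
  also have "\<dots> = (\<integral>\<^sup>+y. f (T y) \<partial>lborel) * c"
    by (rule nn_integral_multc) measurable
  finally have eq: "(\<integral>\<^sup>+x. f x \<partial>lborel) * c = (\<integral>\<^sup>+y. f (T y) \<partial>lborel) * c" .
  have "0 < c" "c < top"
    by (simp_all add: c emeasure_ball emeasure_lborel_ball_finite)
  with eq show ?thesis
    by (auto simp: mult.commute [of _ c] ennreal_mult_cancel_left)
qed

lemma emeasure_lborel_orthogonal_vimage:
  fixes T :: "'a::euclidean_space \<Rightarrow> 'a"
  assumes T: "orthogonal_transformation T" and A: "A \<in> sets borel"
  shows "emeasure lborel (T -` A) = emeasure lborel A"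
proof -
  have [measurable]: "T \<in> borel_measurable borel"
    by (rule borel_measurable_orthogonal_transformation [OF T])
  have "T -` A \<in> sets borel"
    using measurable_sets [of T borel borel A] A by simp
  then have "emeasure lborel (T -` A) = (\<integral>\<^sup>+x. indicator A (T x) \<partial>lborel)"
    by (simp flip: nn_integral_indicator add: indicator_vimage)
  also have "\<dots> = emeasure lborel A"
    using nn_integral_lborel_orthogonal [OF T, of "indicator A"] A by simp
  finally show ?thesis .
qed

lemma distr_uniform_ball_orthogonal:
  fixes T :: "'a::euclidean_space \<Rightarrow> 'a"
  assumes T: "orthogonal_transformation T"
  shows "distr (uniform_measure lborel (ball 0 1)) borel T = uniform_measure lborel (ball 0 1)"
proof (rule measure_eqI)
  have [measurable]: "T \<in> borel_measurable borel"
    by (rule borel_measurable_orthogonal_transformation [OF T])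
  fix A :: "'a set"
  assume "A \<in> sets (distr (uniform_measure lborel (ball 0 1)) borel T)"
  then have A [measurable]: "A \<in> sets borel" by simp
  have TA [measurable]: "T -` A \<in> sets borel"
    using measurable_sets [of T borel borel A] A by simp
  have "ball 0 1 \<inter> T -` A = T -` (ball 0 1 \<inter> A)"
    by (auto simp: orthogonal_transformation_norm [OF T])
  then show "emeasure (distr (uniform_measure lborel (ball 0 1)) borel T) A =
      emeasure (uniform_measure lborel (ball 0 1)) A"
    using TA emeasure_lborel_orthogonal_vimage [OF T, of "ball 0 1 \<inter> A"]
    by (simp add: emeasure_distr del: vimage_Int)
qed simp

lemma integral_uniform_sphere_orthogonal:
  fixes T :: "real ^ 'n \<Rightarrow> real ^ 'n" and f :: "real ^ 'n \<Rightarrow> real"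
  assumes T: "orthogonal_transformation T"
    and f [measurable]: "f \<in> borel_measurable borel"
  shows "(\<integral>x. f (T x) \<partial>uniform_sphere) = (\<integral>x. f x \<partial>uniform_sphere)"
proof -
  have [measurable]: "T \<in> borel_measurable borel"
    by (rule borel_measurable_orthogonal_transformation [OF T])
  have [measurable]: "sgn \<in> borel_measurable (borel :: (real ^ 'n) measure)"
    by (simp add: sgn_div_norm[abs_def])
  let ?B = "uniform_measure lborel (ball (0 :: real ^ 'n) 1)"
  have sgn: "T (sgn x) = sgn (T x)" for x
    by (simp add: sgn_div_norm linear_cmul [OF orthogonal_transformation_linear [OF T]]
        orthogonal_transformation_norm [OF T])
  have "(\<integral>x. f (T x) \<partial>uniform_sphere) = (\<integral>x. f (sgn (T x)) \<partial>?B)"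
    unfolding uniform_sphere_def by (subst integral_distr) (auto simp: sgn)
  also have "\<dots> = (\<integral>x. f (sgn x) \<partial>distr ?B borel T)"
    by (subst integral_distr) auto
  also have "\<dots> = (\<integral>x. f x \<partial>uniform_sphere)"
    unfolding uniform_sphere_def by (subst (2) integral_distr) (auto simp: distr_uniform_ball_orthogonal [OF T])
  finally show ?thesis .
qed

section \<open>Moments of a spherical design\<close>

lemma polynomial_fun_le_monomial:
  assumes "sum a UNIV \<le> t"
  shows "polynomial_fun_le t (monomial_fun a)"
proof -
  have "monomial_fun a = (\<lambda>x. \<Sum>b | sum b UNIV \<le> t. (if b = a then 1 else 0) * monomial_fun b x)"
    using assms by (intro ext) (simp add: finite_exponents if_distrib [of "\<lambda>c. c * _"] cong: if_cong)
  then show ?thesis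
    unfolding polynomial_fun_le_def by (intro exI [of _ "\<lambda>b. if b = a then 1 else 0"])
qed

lemma polynomial_fun_le_lincomb:
  assumes "\<And>i. i \<in> I \<Longrightarrow> polynomial_fun_le t (f i)"
  shows "polynomial_fun_le t (\<lambda>x. \<Sum>i\<in>I. k i * f i x)"
proof -
  obtain c where c: "\<And>i. i \<in> I \<Longrightarrow> f i = (\<lambda>x. \<Sum>a | sum a UNIV \<le> t. c i a * monomial_fun a x)"
    using assms unfolding polynomial_fun_le_def by metis
  have "(\<lambda>x. \<Sum>i\<in>I. k i * f i x)
      = (\<lambda>x. \<Sum>a | sum a UNIV \<le> t. (\<Sum>i\<in>I. k i * c i a) * monomial_fun a x)"
  proof
    fix x
    have "(\<Sum>i\<in>I. k i * f i x) = (\<Sum>i\<in>I. \<Sum>a | sum a UNIV \<le> t. k i * c i a * monomial_fun a x)"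
      by (intro sum.cong refl) (simp add: c sum_distrib_left mult.assoc)
    also have "\<dots> = (\<Sum>a | sum a UNIV \<le> t. (\<Sum>i\<in>I. k i * c i a) * monomial_fun a x)"
      by (subst sum.swap) (simp add: sum_distrib_right)
    finally show "(\<Sum>i\<in>I. k i * f i x) = \<dots>" .
  qed
  then show ?thesis
    unfolding polynomial_fun_le_def by (intro exI [of _ "\<lambda>a. \<Sum>i\<in>I. k i * c i a"])
qed

text \<open>The monomial factor is what makes the induction on \<^term>\<open>k\<close> work: one factor
  \<open>x \<bullet> w\<close> expands into a linear combination of coordinates, and each of them is absorbed into the
  monomial.\<close>

lemma polynomial_fun_le_inner_power_monomial:
  fixes x :: "real ^ 'n"
  assumes "sum a UNIV + k \<le> t"
  shows "polynomial_fun_le t (\<lambda>w. (x \<bullet> w) ^ k * monomial_fun a w)"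
  using assms
proof (induction k arbitrary: a)
  case 0
  then show ?case
    using polynomial_fun_le_monomial [of a t] by simp
next
  case (Suc k)
  define b where "b i j = (if j = i then 1 else 0) + a j" for i j
  have mono: "monomial_fun (b i) w = w $ i * monomial_fun a w" for i w
    by (simp add: monomial_fun_def b_def power_add prod.distrib if_distrib [of "power _"] cong: if_cong)
  have deg: "sum (b i) UNIV = Suc (sum a UNIV)" for i
    by (simp add: b_def sum.distrib)
  have "(\<lambda>w. (x \<bullet> w) ^ Suc k * monomial_fun a w)
      = (\<lambda>w. \<Sum>i\<in>UNIV. x $ i * ((x \<bullet> w) ^ k * monomial_fun (b i) w))"
  proof
    fix w
    have "(x \<bullet> w) ^ Suc k * monomial_fun a w = (\<Sum>i\<in>UNIV. x $ i * w $ i) * ((x \<bullet> w) ^ k * monomial_fun a w)"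
      by (simp add: inner_vec_def)
    also have "\<dots> = (\<Sum>i\<in>UNIV. x $ i * ((x \<bullet> w) ^ k * monomial_fun (b i) w))"
      unfolding sum_distrib_right mono by (simp only: mult_ac)
    finally show "(x \<bullet> w) ^ Suc k * monomial_fun a w = \<dots>" .
  qed
  moreover have "polynomial_fun_le t (\<lambda>w. (x \<bullet> w) ^ k * monomial_fun (b i) w)" for i
    using Suc.prems by (intro Suc.IH) (simp add: deg)
  ultimately show ?case
    by (simp add: polynomial_fun_le_lincomb)
qed

lemma polynomial_fun_le_inner_power:
  "k \<le> t \<Longrightarrow> polynomial_fun_le t (\<lambda>w. (x \<bullet> w) ^ k)"
  using polynomial_fun_le_inner_power_monomial [of "\<lambda>_. 0" k t x]
  by (simp add: monomial_fun_def)

lemma design_inner_self: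
  assumes "spherical_design t X" and "x \<in> X"
  shows "x \<bullet> x = 1"
  using assms by (auto simp: spherical_design_def subset_iff simp flip: power2_norm_eq_inner)

lemma design_inner_eq_1_iff:
  assumes "spherical_design t X" and "x \<in> X" and "y \<in> X"
  shows "x \<bullet> y = 1 \<longleftrightarrow> x = y"
  using design_inner_self [OF assms(1)] assms(2,3) vector_eq [of x y] by metis

text \<open>Orthogonal transformations act transitively on the vectors of a given norm, and the integral over
  the sphere does not see them. So a design of strength \<^term>\<open>t\<close> has moments of degree at
  most \<^term>\<open>t\<close> that depend on the norm of the direction only; all the explicit moments below follow
  from this fact and the points being unit vectors.\<close>

lemma design_power_sum_cong_norm:
  fixes X :: "(real ^ 'n) set"
  assumes X: "spherical_design t X" and k: "k \<le> t" and eq: "norm x = norm y"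
  shows "(\<Sum>w\<in>X. (x \<bullet> w) ^ k) = (\<Sum>w\<in>X. (y \<bullet> w) ^ k)"
proof -
  obtain T where T: "orthogonal_transformation T" and Tx: "T x = y"
    using orthogonal_transformation_exists [OF eq] by blast
  have avg: "(\<Sum>w\<in>X. (z \<bullet> w) ^ k) / real (card X) = (\<integral>w. (z \<bullet> w) ^ k \<partial>uniform_sphere)" for z
    using X polynomial_fun_le_inner_power [OF k] unfolding spherical_design_def by blast
  have "(\<integral>w. (y \<bullet> w) ^ k \<partial>uniform_sphere) = (\<integral>w. (y \<bullet> T w) ^ k \<partial>uniform_sphere)"
    by (rule integral_uniform_sphere_orthogonal [OF T, symmetric]) measurable
  also have "\<dots> = (\<integral>w. (x \<bullet> w) ^ k \<partial>uniform_sphere)"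
    using T by (simp flip: Tx add: orthogonal_transformation_def)
  finally have "(\<Sum>w\<in>X. (y \<bullet> w) ^ k) / real (card X) = (\<Sum>w\<in>X. (x \<bullet> w) ^ k) / real (card X)"
    by (simp flip: avg)
  moreover have "real (card X) \<noteq> 0"
    using X by (simp add: spherical_design_def)
  ultimately show ?thesis
    by simp
qed

lemma design_power_sum_odd:
  assumes "spherical_design t X" and "k \<le> t" and "odd k"
  shows "(\<Sum>w\<in>X. (x \<bullet> w) ^ k) = 0"
  using design_power_sum_cong_norm [OF assms(1,2), of x "- x"] \<open>odd k\<close>
  by (simp add: power_minus_odd sum_negf)

lemma design_power_sum_axis:
  fixes X :: "(real ^ 'n) set"
  assumes "spherical_design t X" and "k \<le> t"
  shows "(\<Sum>w\<in>X. (x \<bullet> w) ^ k) = norm x ^ k * (\<Sum>w\<in>X. (w $ i) ^ k)"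
  using design_power_sum_cong_norm [OF assms, of x "norm x *\<^sub>R axis i 1"]
  by (simp add: power_mult_distrib sum_distrib_left inner_axis' norm_axis_1)

lemma design_moment2:
  fixes X :: "(real ^ 'n) set"
  assumes X: "spherical_design t X" and t: "2 \<le> t"
  shows "(\<Sum>w\<in>X. (x \<bullet> w)\<^sup>2) = real (card X) / CARD('n) * (x \<bullet> x)"
proof -
  fix i0 :: 'n
  define M where "M = (\<Sum>w\<in>X. (w $ i0)\<^sup>2)"
  have M: "(\<Sum>w\<in>X. (x \<bullet> w)\<^sup>2) = (x \<bullet> x) * M" for x
    using design_power_sum_axis [OF X t, of x i0] by (simp add: M_def power2_norm_eq_inner)
  have axis: "(\<Sum>w\<in>X. (w $ i)\<^sup>2) = M" for i
    using M [of "axis i 1"] by (simp add: inner_axis' inner_axis_axis)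
  have "real (card X) = (\<Sum>w\<in>X. w \<bullet> w)"
    by (simp add: design_inner_self [OF X])
  also have "\<dots> = (\<Sum>i\<in>UNIV. \<Sum>w\<in>X. (w $ i)\<^sup>2)"
    by (subst sum.swap) (simp add: inner_vec_def power2_eq_square)
  also have "\<dots> = CARD('n) * M"
    by (simp add: axis)
  finally show ?thesis
    by (simp add: M)
qed

lemma design_moment2_bilinear:
  fixes X :: "(real ^ 'n) set"
  assumes X: "spherical_design t X" and t: "2 \<le> t"
  shows "(\<Sum>w\<in>X. (x \<bullet> w) * (y \<bullet> w)) = real (card X) / CARD('n) * (x \<bullet> y)"
proof -
  have "4 * (\<Sum>w\<in>X. (x \<bullet> w) * (y \<bullet> w))
      = (\<Sum>w\<in>X. ((x + y) \<bullet> w)\<^sup>2) - (\<Sum>w\<in>X. ((x - y) \<bullet> w)\<^sup>2)"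
    unfolding sum_subtractf [symmetric] sum_distrib_left
    by (rule sum.cong) (simp_all add: inner_simps power2_eq_square algebra_simps)
  also have "\<dots> = real (card X) / CARD('n) * ((x + y) \<bullet> (x + y) - (x - y) \<bullet> (x - y))"
    by (simp only: design_moment2 [OF X t] right_diff_distrib)
  also have "(x + y) \<bullet> (x + y) - (x - y) \<bullet> (x - y) = 4 * (x \<bullet> y)"
    by (simp add: inner_simps inner_commute)
  finally show ?thesis
    by (simp add: field_simps)
qed

text \<open>Cubes sum to 0 in every direction, and polarization recovers the trilinear form from its cubes.\<close>

lemma design_moment3_trilinear:
  fixes X :: "(real ^ 'n) set"
  assumes X: "spherical_design t X" and t: "3 \<le> t"
  shows "(\<Sum>w\<in>X. (x \<bullet> w) * (y \<bullet> w) * (z \<bullet> w)) = 0"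
proof -
  have cube: "(\<Sum>w\<in>X. (v \<bullet> w) ^ 3) = 0" for v
    by (rule design_power_sum_odd [OF X t]) simp
  have "6 * (\<Sum>w\<in>X. (x \<bullet> w) * (y \<bullet> w) * (z \<bullet> w))
      = (\<Sum>w\<in>X. ((x + y + z) \<bullet> w) ^ 3 - ((x + y) \<bullet> w) ^ 3 - ((y + z) \<bullet> w) ^ 3
          - ((x + z) \<bullet> w) ^ 3 + (x \<bullet> w) ^ 3 + (y \<bullet> w) ^ 3 + (z \<bullet> w) ^ 3)"
    unfolding sum_distrib_left
    by (rule sum.cong) (simp_all add: inner_simps power3_eq_cube algebra_simps)
  also have "\<dots> = 0"
    by (simp only: sum.distrib sum_subtractf cube)
  finally show ?thesis
    by simp
qed

text \<open>Let \<open>M\<close> be the power sum in a coordinate direction. Comparing the directions \<open>e\<^sub>i + e\<^sub>j\<close> and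
  \<open>e\<^sub>i - e\<^sub>j\<close>, both of squared norm 2, gives \<open>M / 3\<close> for the mixed moments with distinct indices. Then \<open>M\<close> is determined by
  summing \<open>1 = (w \<bullet> w)\<^sup>2\<close> over the design.\<close>

lemma design_moment4:
  fixes X :: "(real ^ 'n) set"
  assumes X: "spherical_design t X" and t: "4 \<le> t"
  shows "(\<Sum>w\<in>X. (x \<bullet> w) ^ 4)
      = 3 * real (card X) / (real CARD('n) * (real CARD('n) + 2)) * (x \<bullet> x)\<^sup>2"
proof -
  fix i0 :: 'n
  define M where "M = (\<Sum>w\<in>X. (w $ i0) ^ 4)"
  have M: "(\<Sum>w\<in>X. (x \<bullet> w) ^ 4) = (x \<bullet> x)\<^sup>2 * M" for x
    using design_power_sum_axis [OF X t, of x i0] by (simp add: M_def flip: power2_norm_eq_inner)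
  have axis: "(\<Sum>w\<in>X. (w $ i) ^ 4) = M" for i
    using M [of "axis i 1"] by (simp add: inner_axis' inner_axis_axis)
  have mixed: "(\<Sum>w\<in>X. (w $ i)\<^sup>2 * (w $ j)\<^sup>2) = (if i = j then M else M / 3)" for i j
  proof (cases "i = j")
    case True
    then show ?thesis
      using axis [of j] by (simp flip: power_add)
  next
    case False
    let ?e = "axis i 1 :: real ^ 'n" and ?f = "axis j 1 :: real ^ 'n"
    have ef: "?e \<bullet> ?f = 0" "?f \<bullet> ?e = 0" "?e \<bullet> ?e = 1" "?f \<bullet> ?f = 1"
      using False by (simp_all add: inner_axis_axis)
    have "12 * (\<Sum>w\<in>X. (w $ i)\<^sup>2 * (w $ j)\<^sup>2)
        = (\<Sum>w\<in>X. ((?e + ?f) \<bullet> w) ^ 4 + ((?e - ?f) \<bullet> w) ^ 4 - 2 * (w $ i) ^ 4 - 2 * (w $ j) ^ 4)"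
      unfolding sum_distrib_left
      by (rule sum.cong) (simp_all add: inner_simps inner_axis' power2_eq_square power4_eq_xxxx algebra_simps)
    also have "\<dots> = (((?e + ?f) \<bullet> (?e + ?f))\<^sup>2 + ((?e - ?f) \<bullet> (?e - ?f))\<^sup>2 - 4) * M"
      by (simp add: sum.distrib sum_subtractf M axis flip: sum_distrib_left) (simp add: algebra_simps)
    also have "\<dots> = 4 * M"
      by (simp add: inner_simps ef)
    finally show ?thesis
      using False by simp
  qed
  have "real (card X) = (\<Sum>w\<in>X. (w \<bullet> w)\<^sup>2)"
    by (simp add: design_inner_self [OF X])
  also have "\<dots> = (\<Sum>w\<in>X. \<Sum>i\<in>UNIV. \<Sum>j\<in>UNIV. (w $ i)\<^sup>2 * (w $ j)\<^sup>2)"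
    by (simp add: inner_vec_def power2_eq_square sum_product)
  also have "\<dots> = (\<Sum>i\<in>UNIV. \<Sum>j\<in>UNIV. \<Sum>w\<in>X. (w $ i)\<^sup>2 * (w $ j)\<^sup>2)"
    by (subst sum.swap) (subst sum.swap, rule refl)
  also have "\<dots> = (\<Sum>i\<in>(UNIV::'n set). \<Sum>j\<in>(UNIV::'n set). M / 3 + (if i = j then 2 * M / 3 else 0))"
    by (intro sum.cong refl) (simp add: mixed)
  also have "\<dots> = real CARD('n) * (real CARD('n) + 2) * M / 3"
    by (simp add: sum.distrib) (simp add: algebra_simps)
  finally have "M = 3 * real (card X) / (real CARD('n) * (real CARD('n) + 2))"
    by (simp add: field_simps add_nonneg_eq_0_iff)
  then show ?thesis
    by (simp add: M)
qed

section \<open>Inner products in a tight 4-design\<close>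

lemma tight_4_design_card:
  fixes X :: "(real ^ 'n) set"
  assumes "tight_spherical_design 4 X"
  shows "2 * real (card X) = real CARD('n) * (real CARD('n) + 3)"
proof -
  define d where "d = CARD('n)"
  have "0 < d" by (simp add: d_def)
  have "card X = (Suc d choose 2) + d"
    using assms by (simp add: tight_spherical_design_def flip: d_def)
  then have "2 * card X = d * (d + 3)"
    by (simp add: choose_two algebra_simps)
  then have "real (2 * card X) = real (d * (d + 3))"
    by (simp only:)
  then show ?thesis
    by (simp add: d_def)
qed

text \<open>The sum of squares of the polynomial \<open>F\<close> over the whole design equals its single term at
  \<^term>\<open>x\<close>. This is where tightness is used: for a larger design the sum exceeds that term.\<close>

lemma tight_4_design_inner_root:
  fixes X :: "(real ^ 'n) set"
  assumes X: "tight_spherical_design 4 X" and x: "x \<in> X" and y: "y \<in> X" and "x \<noteq> y"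
  shows "(real CARD('n) + 2) * (x \<bullet> y)\<^sup>2 + 2 * (x \<bullet> y) - 1 = 0"
proof -
  define d where "d = real CARD('n)"
  define F where "F u = (d + 2) * u\<^sup>2 + 2 * u - 1" for u :: real
  have "0 < d" by (simp add: d_def)
  have des: "spherical_design 4 X"
    using X by (simp add: tight_spherical_design_def)
  then have "finite X"
    by (simp add: spherical_design_def)
  have unit: "x \<bullet> x = 1"
    by (rule design_inner_self [OF des x])
  have N: "real (card X) = d * (d + 3) / 2"
    using tight_4_design_card [OF X] by (simp add: d_def)
  have m1: "(\<Sum>w\<in>X. x \<bullet> w) = 0" and m3: "(\<Sum>w\<in>X. (x \<bullet> w) ^ 3) = 0"
    using design_power_sum_odd [OF des, of 1 x] design_power_sum_odd [OF des, of 3 x] by simp_all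
  have m2: "(\<Sum>w\<in>X. (x \<bullet> w)\<^sup>2) = (d + 3) / 2"
    using design_moment2 [OF des, of x] \<open>0 < d\<close> by (simp add: N unit flip: d_def)
  have m4: "(\<Sum>w\<in>X. (x \<bullet> w) ^ 4) = 3 * (d + 3) / (2 * (d + 2))"
    using design_moment4 [OF des, of x] \<open>0 < d\<close> by (simp add: N unit flip: d_def)
  have "(F u)\<^sup>2 = 1 - 4 * u - 2 * d * u\<^sup>2 + 4 * (d + 2) * u ^ 3 + (d + 2)\<^sup>2 * u ^ 4" for u
    unfolding F_def by algebra
  then have "(\<Sum>w\<in>X. (F (x \<bullet> w))\<^sup>2) = real (card X) - 2 * d * ((d + 3) / 2)
      + (d + 2)\<^sup>2 * (3 * (d + 3) / (2 * (d + 2)))"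
    by (simp only: sum.distrib sum_subtractf m1 m2 m3 m4 flip: sum_distrib_left) simp
  also have "\<dots> = (d + 3)\<^sup>2"
    using \<open>0 < d\<close> by (simp add: N field_simps power2_eq_square)
  also have "\<dots> = (F (x \<bullet> x))\<^sup>2"
    by (simp add: F_def unit add.commute)
  finally have "(\<Sum>w\<in>X - {x}. (F (x \<bullet> w))\<^sup>2) = 0"
    using \<open>finite X\<close> x by (simp add: sum.remove)
  then have "F (x \<bullet> y) = 0"
    using \<open>finite X\<close> y \<open>x \<noteq> y\<close> by (subst (asm) sum_nonneg_eq_0_iff) auto
  then show ?thesis
    by (simp add: F_def d_def)
qed

text \<open>The two roots of the quadratic are distinct, so an affine function of the inner product can
  take the value 1 at the root \<open>a\<close> and 0 at the other root \<open>b\<close>. The constant \<open>r\<close> repairs the value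
  at \<open>w = x\<close>, where the inner product is 1, which is not a root; for \<open>a = 1\<close> the correction is the
  whole indicator.\<close>

lemma tight_4_design_indicator:
  fixes X :: "(real ^ 'n) set"
  assumes X: "tight_spherical_design 4 X"
    and a: "a = 1 \<or> (\<exists>x\<in>X. \<exists>y\<in>X. x \<noteq> y \<and> x \<bullet> y = a)"
  shows "\<exists>p q r. \<forall>x\<in>X. \<forall>w\<in>X.
    (if w \<bullet> x = a then 1 else 0) = p + q * (w \<bullet> x) + (if w = x then r else (0::real))"
proof -
  have des: "spherical_design 4 X"
    using X by (simp add: tight_spherical_design_def)
  note unit = design_inner_self [OF des] and unit_eq = design_inner_eq_1_iff [OF des]
  show ?thesis
  proof (cases "a = 1")
    case True
    then show ?thesis
      by (intro exI [of _ 0] exI [of _ 1]) (simp add: unit_eq)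
  next
    case False
    define c where "c = real CARD('n) + 2"
    have "0 < c" by (simp add: c_def)
    have root: "c * (w \<bullet> x)\<^sup>2 + 2 * (w \<bullet> x) - 1 = 0" if "w \<in> X" "x \<in> X" "w \<noteq> x" for w x
      using tight_4_design_inner_root [OF X that] by (simp add: c_def)
    have ra: "c * a\<^sup>2 + 2 * a - 1 = 0"
      using a False root by blast
    \<comment> \<open>The other root, since by Vieta the two roots add up to \<open>- 2 / c\<close>.\<close>
    define b where "b = - 2 / c - a"
    have other: "u = a \<or> u = b" if "c * u\<^sup>2 + 2 * u - 1 = 0" for u
    proof -
      have "c * ((u - a) * (u - b)) = (c * u\<^sup>2 + 2 * u - 1) - (c * a\<^sup>2 + 2 * a - 1)"
        using \<open>0 < c\<close> by (simp add: b_def field_simps power2_eq_square)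
      then show ?thesis
        using that ra \<open>0 < c\<close> by simp
    qed
    have "a \<noteq> b"
    proof
      assume "a = b"
      then have "c * a = - 1"
        using \<open>0 < c\<close> by (simp add: b_def field_simps)
      then have "c * a\<^sup>2 = - a"
        by (simp add: power2_eq_square flip: mult.assoc)
      with ra have "a = 1" by simp
      with False show False ..
    qed
    have "(if w \<bullet> x = a then 1 else 0) = - b / (a - b) + 1 / (a - b) * (w \<bullet> x)
        + (if w = x then - (1 - b) / (a - b) else (0::real))" if "x \<in> X" "w \<in> X" for w x
    proof (cases "w = x")
      case True
      then show ?thesis
        using False \<open>a \<noteq> b\<close> unit [OF \<open>x \<in> X\<close>] by (simp add: field_simps)
    next
      case ne: False
      have "- b / (a - b) + 1 / (a - b) * (w \<bullet> x) = (w \<bullet> x - b) / (a - b)"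
        by (simp add: diff_divide_distrib)
      then show ?thesis
        using other [OF root [OF that(2,1) ne]] \<open>a \<noteq> b\<close> ne by auto
    qed
    then show ?thesis by blast
  qed
qed

section \<open>Triple counts\<close>

text \<open>Only the shape of the right-hand side matters later: it is a function of the three inner
  products. The product is expanded so that each correction term meets only affine parts of the
  factors before it and complete factors after it; evaluating at its point then gives one summand.\<close>

lemma design_triple_sum:
  fixes X :: "(real ^ 'n) set" and p q r :: "nat \<Rightarrow> real"
  assumes X: "spherical_design t X" and t: "3 \<le> t"
  defines "A \<equiv> \<lambda>i u. p i + q i * u"
    and "D \<equiv> \<lambda>i u. if u = 1 then r i else 0"
  assumes x: "x \<in> X" and y: "y \<in> X" and z: "z \<in> X"
  shows "(\<Sum>w\<in>X. (p 0 + q 0 * (w \<bullet> x) + (if w = x then r 0 else 0))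
               * (p 1 + q 1 * (w \<bullet> y) + (if w = y then r 1 else 0))
               * (p 2 + q 2 * (w \<bullet> z) + (if w = z then r 2 else 0)))
    = real (card X) * p 0 * p 1 * p 2
      + real (card X) / CARD('n) * (p 0 * q 1 * q 2 * (y \<bullet> z) + q 0 * p 1 * q 2 * (z \<bullet> x)
          + q 0 * q 1 * p 2 * (x \<bullet> y))
      + r 0 * (A 1 (x \<bullet> y) + D 1 (x \<bullet> y)) * (A 2 (z \<bullet> x) + D 2 (z \<bullet> x))
      + r 1 * A 0 (x \<bullet> y) * (A 2 (y \<bullet> z) + D 2 (y \<bullet> z))
      + r 2 * A 0 (z \<bullet> x) * A 1 (y \<bullet> z)"
    (is "(\<Sum>w\<in>X. ?h 0 x w * ?h 1 y w * ?h 2 z w) = ?rhs")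
proof -
  have "finite X"
    using X by (simp add: spherical_design_def)
  have h: "?h i v w = A i (w \<bullet> v) + D i (w \<bullet> v)" if "w \<in> X" "v \<in> X" for i v w
    using design_inner_eq_1_iff [OF X that] by (simp add: A_def D_def)
  have point: "(\<Sum>w\<in>X. (if w = v then c else 0) * g w) = c * g v" if "v \<in> X" for v c and g :: "real ^ 'n \<Rightarrow> real"
    using \<open>finite X\<close> that by (simp add: if_distrib [of "\<lambda>a. a * _"] cong: if_cong)
  have lin: "(\<Sum>w\<in>X. v \<bullet> w) = 0" for v
    using design_power_sum_odd [OF X, of 1 v] t by simp
  note bil = design_moment2_bilinear [OF X]
  have smooth: "(\<Sum>w\<in>X. A 0 (w \<bullet> x) * A 1 (w \<bullet> y) * A 2 (w \<bullet> z)) =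
      real (card X) * p 0 * p 1 * p 2
      + real (card X) / CARD('n) * (p 0 * q 1 * q 2 * (y \<bullet> z) + q 0 * p 1 * q 2 * (z \<bullet> x)
          + q 0 * q 1 * p 2 * (x \<bullet> y))"
  proof -
    have "(\<Sum>w\<in>X. A 0 (w \<bullet> x) * A 1 (w \<bullet> y) * A 2 (w \<bullet> z))
      = (\<Sum>w\<in>X. p 0 * p 1 * p 2 + q 0 * p 1 * p 2 * (x \<bullet> w) + p 0 * q 1 * p 2 * (y \<bullet> w)
          + p 0 * p 1 * q 2 * (z \<bullet> w) + p 0 * q 1 * q 2 * ((y \<bullet> w) * (z \<bullet> w))
          + q 0 * p 1 * q 2 * ((z \<bullet> w) * (x \<bullet> w)) + q 0 * q 1 * p 2 * ((x \<bullet> w) * (y \<bullet> w))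
          + q 0 * q 1 * q 2 * ((x \<bullet> w) * (y \<bullet> w) * (z \<bullet> w)))"
      by (intro sum.cong refl) (simp add: A_def inner_commute algebra_simps)
    also have "\<dots> = real (card X) * p 0 * p 1 * p 2
      + real (card X) / CARD('n) * (p 0 * q 1 * q 2 * (y \<bullet> z) + q 0 * p 1 * q 2 * (z \<bullet> x)
          + q 0 * q 1 * p 2 * (x \<bullet> y))"
      using t by (simp only: sum.distrib lin bil design_moment3_trilinear [OF X t] flip: sum_distrib_left)
        (simp add: bil algebra_simps)
    finally show ?thesis .
  qed
  have "(\<Sum>w\<in>X. ?h 0 x w * ?h 1 y w * ?h 2 z w)
      = (\<Sum>w\<in>X. A 0 (w \<bullet> x) * A 1 (w \<bullet> y) * A 2 (w \<bullet> z)
          + (if w = x then r 0 else 0) * (?h 1 y w * ?h 2 z w)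
          + (if w = y then r 1 else 0) * (A 0 (w \<bullet> x) * ?h 2 z w)
          + (if w = z then r 2 else 0) * (A 0 (w \<bullet> x) * A 1 (w \<bullet> y)))"
    by (intro sum.cong refl) (simp add: A_def algebra_simps)
  also have "\<dots> = (\<Sum>w\<in>X. A 0 (w \<bullet> x) * A 1 (w \<bullet> y) * A 2 (w \<bullet> z))
      + r 0 * (?h 1 y x * ?h 2 z x) + r 1 * (A 0 (y \<bullet> x) * ?h 2 z y)
      + r 2 * (A 0 (z \<bullet> x) * A 1 (z \<bullet> y))"
    by (simp only: sum.distrib point [OF x] point [OF y] point [OF z])
  also have "\<dots> = ?rhs"
    by (simp only: smooth h [OF x y] h [OF x z] h [OF y z])
       (simp add: inner_commute [of x z] inner_commute [of y x] inner_commute [of z y] mult.assoc)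
  finally show ?thesis .
qed

lemma tight_4_design_triple_count:
  fixes X :: "(real ^ 'n) set"
  assumes X: "tight_spherical_design 4 X"
    and abc: "\<And>e. e \<in> {a, b, c} \<Longrightarrow> e = 1 \<or> (\<exists>x\<in>X. \<exists>y\<in>X. x \<noteq> y \<and> x \<bullet> y = e)"
  shows "\<exists>\<Phi>. \<forall>x\<in>X. \<forall>y\<in>X. \<forall>z\<in>X.
    real (card {w \<in> X. w \<bullet> x = a \<and> w \<bullet> y = b \<and> w \<bullet> z = c}) = \<Phi> (x \<bullet> y) (y \<bullet> z) (z \<bullet> x)"
proof -
  have des: "spherical_design 4 X" and fin: "finite X"
    using X by (auto simp: tight_spherical_design_def spherical_design_def)
  define e where "e i = (if i = 0 then a else if i = 1 then b else c)" for i :: nat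
  have "\<forall>i. \<exists>p q r. \<forall>x\<in>X. \<forall>w\<in>X.
    (if w \<bullet> x = e i then 1 else 0) = p + q * (w \<bullet> x) + (if w = x then r else (0::real))"
    using abc by (intro allI tight_4_design_indicator [OF X]) (simp add: e_def)
  then obtain p q r where ind: "\<And>i x w. x \<in> X \<Longrightarrow> w \<in> X \<Longrightarrow>
    (if w \<bullet> x = e i then 1 else 0) = p i + q i * (w \<bullet> x) + (if w = x then r i else (0::real))"
    unfolding choice_iff by blast
  have count: "real (card {w \<in> X. w \<bullet> x = a \<and> w \<bullet> y = b \<and> w \<bullet> z = c})
    = (\<Sum>w\<in>X. (p 0 + q 0 * (w \<bullet> x) + (if w = x then r 0 else 0))
             * (p 1 + q 1 * (w \<bullet> y) + (if w = y then r 1 else 0))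
             * (p 2 + q 2 * (w \<bullet> z) + (if w = z then r 2 else 0)))"
    if "x \<in> X" "y \<in> X" "z \<in> X" for x y z
  proof -
    have "real (card {w \<in> X. w \<bullet> x = a \<and> w \<bullet> y = b \<and> w \<bullet> z = c})
      = (\<Sum>w\<in>X. if w \<bullet> x = a \<and> w \<bullet> y = b \<and> w \<bullet> z = c then 1 else 0)"
      using fin by (simp flip: sum.inter_filter)
    also have "\<dots> = (\<Sum>w\<in>X. (if w \<bullet> x = e 0 then 1 else 0) * (if w \<bullet> y = e 1 then 1 else 0)
        * (if w \<bullet> z = e 2 then 1 else 0))"
      by (intro sum.cong refl) (simp add: e_def)
    finally show ?thesis
      using that by (simp only: ind cong: sum.cong)
  qed
  \<comment> \<open>The right-hand side of the triple sum serves as \<open>\<Phi>\<close>; unification abstracts the inner products.\<close>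
  show ?thesis
    by (rule exI, intro ballI, rule trans [OF count design_triple_sum [OF des]]) auto
qed

theorem corollary3p1:
  fixes X :: "(real ^ 'n) set" and s :: nat and \<alpha> :: "nat \<Rightarrow> real"
    and R :: "nat \<Rightarrow> ((real ^ 'n) \<times> (real ^ 'n)) set"
  assumes "CARD('n) \<ge> 3"
    and "tight_spherical_design 4 X"
    and "{x \<bullet> y | x y. x \<in> X \<and> y \<in> X \<and> x \<noteq> y} = \<alpha> ` {1..s}"
    and "inj_on \<alpha> {1..s}"
    and "\<alpha> 0 = 1"
    and "\<And>k. k \<le> s \<Longrightarrow> R k = {(x, y) \<in> X \<times> X. x \<bullet> y = \<alpha> k}"
  shows "triply_regular_scheme X s R"
proof -
  note tight = assms(2) and R = assms(6)
  have des: "spherical_design 4 X" and fin: "finite X" and ne: "X \<noteq> {}"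
    using tight by (auto simp: tight_spherical_design_def spherical_design_def)
  note unit = design_inner_self [OF des] and unit_eq = design_inner_eq_1_iff [OF des]
  have attained: "\<exists>x\<in>X. \<exists>y\<in>X. x \<noteq> y \<and> x \<bullet> y = \<alpha> k" if "k \<in> {1..s}" for k
  proof -
    have "\<alpha> k \<in> {x \<bullet> y | x y. x \<in> X \<and> y \<in> X \<and> x \<noteq> y}"
      unfolding assms(3) using that by (rule imageI)
    then show ?thesis by force
  qed
  have level: "\<alpha> k = 1 \<or> (\<exists>x\<in>X. \<exists>y\<in>X. x \<noteq> y \<and> x \<bullet> y = \<alpha> k)" if "k \<le> s" for k
    using attained [of k] that \<open>\<alpha> 0 = 1\<close> by (cases "k = 0") auto
  have cover: "\<exists>k\<le>s. x \<bullet> y = \<alpha> k" if "x \<in> X" "y \<in> X" for x y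
  proof (cases "x = y")
    case True
    then show ?thesis
      using unit [OF \<open>x \<in> X\<close>] \<open>\<alpha> 0 = 1\<close> by (intro exI [of _ 0]) simp
  next
    case False
    then have "x \<bullet> y \<in> \<alpha> ` {1..s}"
      unfolding assms(3) [symmetric] using that by blast
    then show ?thesis by auto
  qed
  have inj: "inj_on \<alpha> {..s}"
  proof -
    have "\<alpha> 0 \<notin> \<alpha> ` {1..s}"
      unfolding assms(3) [symmetric] using unit_eq \<open>\<alpha> 0 = 1\<close> by force
    moreover have "{..s} = insert 0 {1..s}"
      by auto
    ultimately show ?thesis
      using assms(4) by simp
  qed
  have triple: "\<exists>p. \<forall>x\<in>X. \<forall>y\<in>X. \<forall>z\<in>X.
      (x, y) \<in> R i \<longrightarrow> (y, z) \<in> R j \<longrightarrow> (z, x) \<in> R k \<longrightarrow>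
        card {w \<in> X. (w, x) \<in> R m \<and> (w, y) \<in> R n \<and> (w, z) \<in> R l} = p"
    if le: "i \<le> s" "j \<le> s" "k \<le> s" "l \<le> s" "m \<le> s" "n \<le> s" for i j k l m n
  proof -
    obtain \<Phi> where \<Phi>: "\<forall>x\<in>X. \<forall>y\<in>X. \<forall>z\<in>X.
        real (card {w \<in> X. w \<bullet> x = \<alpha> m \<and> w \<bullet> y = \<alpha> n \<and> w \<bullet> z = \<alpha> l})
          = \<Phi> (x \<bullet> y) (y \<bullet> z) (z \<bullet> x)"
      using tight_4_design_triple_count [OF tight, of "\<alpha> m" "\<alpha> n" "\<alpha> l"] level le by blast
    have "card {w \<in> X. (w, x) \<in> R m \<and> (w, y) \<in> R n \<and> (w, z) \<in> R l} = nat \<lfloor>\<Phi> (\<alpha> i) (\<alpha> j) (\<alpha> k)\<rfloor>"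
      if xyz: "x \<in> X" "y \<in> X" "z \<in> X" and "(x, y) \<in> R i" "(y, z) \<in> R j" "(z, x) \<in> R k" for x y z
    proof -
      have "{w \<in> X. (w, x) \<in> R m \<and> (w, y) \<in> R n \<and> (w, z) \<in> R l}
          = {w \<in> X. w \<bullet> x = \<alpha> m \<and> w \<bullet> y = \<alpha> n \<and> w \<bullet> z = \<alpha> l}"
        using xyz le by (auto simp: R)
      moreover have "x \<bullet> y = \<alpha> i" "y \<bullet> z = \<alpha> j" "z \<bullet> x = \<alpha> k"
        using that le by (auto simp: R)
      ultimately have count: "real (card {w \<in> X. (w, x) \<in> R m \<and> (w, y) \<in> R n \<and> (w, z) \<in> R l})
          = \<Phi> (\<alpha> i) (\<alpha> j) (\<alpha> k)"
        using \<Phi> [rule_format, OF xyz] by (simp only:)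
      then show ?thesis
        by (simp flip: count)
    qed
    then show ?thesis by blast
  qed
  have sym: "(y, x) \<in> R k" if "(x, y) \<in> R k" "k \<le> s" for x y k
    using that by (auto simp: R inner_commute)
  have "symmetric_association_scheme X s R"
    unfolding symmetric_association_scheme_def
  proof (intro conjI allI impI)
    show "finite X" by fact
    show "(\<Union>k\<le>s. R k) = X \<times> X"
      using cover by (auto simp: R)
    show "disjoint_family_on R {..s}"
      using inj by (auto simp: disjoint_family_on_def R inj_on_def)
    show "R k \<noteq> {}" if "k \<le> s" for k
    proof (cases "k = 0")
      case True
      then show ?thesis using ne unit \<open>\<alpha> 0 = 1\<close> by (auto simp: R)
    next
      case False
      then show ?thesis using attained [of k] that by (auto simp: R)
    qed
    show "sym (R k)" if "k \<le> s" for k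
      using that sym by (auto intro: symI)
    show R0: "R 0 = Id_on X"
      using \<open>\<alpha> 0 = 1\<close> unit unit_eq by (auto simp: R Id_on_def)
    show "\<exists>p. \<forall>x y. (x, y) \<in> R k \<longrightarrow> card {w \<in> X. (x, w) \<in> R i \<and> (w, y) \<in> R j} = p"
      if le: "i \<le> s" "j \<le> s" "k \<le> s" for i j k
    proof -
      \<comment> \<open>With \<open>z = x\<close> and equal conditions on \<open>x\<close> and \<open>z\<close>, a triple count is an intersection number.\<close>
      obtain p where p: "\<forall>x\<in>X. \<forall>y\<in>X. \<forall>z\<in>X.
          (x, y) \<in> R k \<longrightarrow> (y, z) \<in> R k \<longrightarrow> (z, x) \<in> R 0 \<longrightarrow>
            card {w \<in> X. (w, x) \<in> R i \<and> (w, y) \<in> R j \<and> (w, z) \<in> R i} = p"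
        using triple [of k k 0 i i j] le by blast
      have "card {w \<in> X. (x, w) \<in> R i \<and> (w, y) \<in> R j} = p" if xy: "(x, y) \<in> R k" for x y
      proof -
        have "x \<in> X" "y \<in> X"
          using xy le by (auto simp: R)
        moreover have "(y, x) \<in> R k" "(x, x) \<in> R 0"
          using xy le sym R0 \<open>x \<in> X\<close> by auto
        ultimately have "card {w \<in> X. (w, x) \<in> R i \<and> (w, y) \<in> R j \<and> (w, x) \<in> R i} = p"
          using p xy by blast
        moreover have "{w \<in> X. (x, w) \<in> R i \<and> (w, y) \<in> R j}
            = {w \<in> X. (w, x) \<in> R i \<and> (w, y) \<in> R j \<and> (w, x) \<in> R i}"
          using sym le by blast
        ultimately show ?thesis by simp
      qed
      then show ?thesis by blast
    qed
  qed
  with triple show ?thesis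
    unfolding triply_regular_scheme_def by blast
qed

end
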